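(* For all $m, n \in \mathbb{N}$, the set $$\mathcal{CS}_\infty(\mathbb{R}^m,\mathbb{C}^n) = \left\{ f \in \mathcal{C}(\mathbb{R}^m,\mathbb{C}^n) : f^{-1}(\{a\}) \text{ is unbounded for every } a \in \mathbb{C}^n \right\}$$ is maximal strongly algebrable in $\mathcal{C}(\mathbb{R}^m,\mathbb{C}^n)$.
   Context: $\mathbb{N}=\{1,2,\dots\}$. $\mathcal{C}(\mathbb{R}^m,\mathbb{C}^n)$ is the set of all continuous maps $\mathbb{R}^m\to\mathbb{C}^n$, regarded as a commutative complex algebra with pointwise operations, where $\mathbb{C}^n$ carries the coordinatewise product. Let $\mathcal{A}$ be a commutative complex algebra, $\mathcal{B}\subset\mathcal{A}$ and $\kappa$ a cardinal. $\mathcal{B}$ is strongly $\kappa$-algebrable if there is a $\kappa$-generated free algebra contained in $\mathcal{B}\cup\{0\}$; that is, there is a set $C\subset\mathcal{A}$ with $\mathrm{card}(C)=\kappa$ such that for every finite set $\{x_1,\dots,x_N\}\subset C$ of distinct elements and every nonzero polynomial $P$ in $N$ variables (complex coefficients) without constant term, one has $P(x_1,\dots,x_N)\in\mathcal{B}\setminus\{0\}$. A set $C\subset\mathcal{A}$ is an algebraically free system if $P(x_1,\dots,x_N)\neq 0$ for all such $x_1,\dots,x_N$ and $P$. $\mathcal{B}$ is maximal strongly algebrable in $\mathcal{A}$ if it is strongly $\kappa$-algebrable with $\kappa$ equal to the supremum of the cardinalities of all algebraically free systems in $\mathcal{A}$ (for $\mathcal{A}=\mathcal{C}(\mathbb{R}^m,\mathbb{C}^n)$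 this means strongly $\mathfrak{c}$-algebrable, where $\mathfrak{c}$ is the cardinality of the continuum). *)

theory Defs
  imports
    "HOL-Analysis.Analysis"
    "HOL-Library.Function_Algebras"
    "HOL-Library.Poly_Mapping"
begin

unbundle cardinal_syntax

text \<open>
  Polynomials in the variables \<open>X\<^sub>0, X\<^sub>1, \<dots>\<close> with complex coefficients are finitely supported
  maps from monomials to coefficients, a monomial being a finitely supported exponent map.
\<close>

type_synonym cpoly = "(nat \<Rightarrow>\<^sub>0 nat) \<Rightarrow>\<^sub>0 complex"

definition poly_vars :: "cpoly \<Rightarrow> nat set" where
  "poly_vars P = (\<Union>e\<in>Poly_Mapping.keys P. Poly_Mapping.keys e)"

definition no_constant_term :: "cpoly \<Rightarrow> bool" where
  "no_constant_term P \<longleftrightarrow> Poly_Mapping.lookup P 0 = 0"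

text \<open>
  Supremum of a set of cardinals, each represented by a cardinal order on a subset of a fixed
  type. Comparing only with cardinal orders on the same type is no restriction: any two cardinals
  are comparable, so an upper bound too large for the type exceeds every cardinal living on it.
\<close>

definition is_card_Sup :: "'a rel set \<Rightarrow> 'a rel \<Rightarrow> bool" where
  "is_card_Sup K \<kappa> \<longleftrightarrow>
     Card_order \<kappa> \<and> (\<forall>r\<in>K. r \<le>o \<kappa>) \<and>
     (\<forall>\<kappa>'::'a rel. Card_order \<kappa>' \<and> (\<forall>r\<in>K. r \<le>o \<kappa>') \<longrightarrow> \<kappa> \<le>o \<kappa>')"

text \<open>
  The commutative complex algebra is the set \<open>A\<close>, a (not necessarily unital) subalgebra of a
  commutative complex algebra whose elements form a whole type.
\<close>

locale comm_complex_algebra = vector_space scale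
  for scale :: "complex \<Rightarrow> 'a::comm_ring_1 \<Rightarrow> 'a" +
  fixes A :: "'a set"
  assumes scale_mult_left: "scale c (x * y) = scale c x * y"
    and subspace_carrier: "subspace A"
    and mult_closed: "x \<in> A \<Longrightarrow> y \<in> A \<Longrightarrow> x * y \<in> A"
begin

definition eval_poly :: "cpoly \<Rightarrow> (nat \<Rightarrow> 'a) \<Rightarrow> 'a" where
  "eval_poly P x =
     (\<Sum>e\<in>Poly_Mapping.keys P.
        scale (Poly_Mapping.lookup P e)
          (\<Prod>i\<in>Poly_Mapping.keys e. x i ^ Poly_Mapping.lookup e i))"

definition algebraically_free :: "'a set \<Rightarrow> bool" where
  "algebraically_free C \<longleftrightarrow>
     C \<subseteq> A \<and>
     (\<forall>(N::nat) x P. inj_on x {..<N} \<and> x ` {..<N} \<subseteq> C \<and>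
        P \<noteq> 0 \<and> poly_vars P \<subseteq> {..<N} \<and> no_constant_term P \<longrightarrow> eval_poly P x \<noteq> 0)"

definition strongly_algebrable :: "'k rel \<Rightarrow> 'a set \<Rightarrow> bool" where
  "strongly_algebrable \<kappa> B \<longleftrightarrow>
     (\<exists>C\<subseteq>A. |C| =o \<kappa> \<and>
        (\<forall>(N::nat) x P. inj_on x {..<N} \<and> x ` {..<N} \<subseteq> C \<and>
           P \<noteq> 0 \<and> poly_vars P \<subseteq> {..<N} \<and> no_constant_term P \<longrightarrow> eval_poly P x \<in> B - {0}))"

definition maximal_strongly_algebrable :: "'a set \<Rightarrow> bool" where
  "maximal_strongly_algebrable B \<longleftrightarrow>
     (\<exists>\<kappa>. is_card_Sup {|C| |C. algebraically_free C} \<kappa> \<and> strongly_algebrable \<kappa> B)"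

end

text \<open>
  Addition and multiplication on \<open>real^'m \<Rightarrow> complex^'n\<close> are pointwise and coordinatewise via the
  type class instances for functions and vectors; only scaling by complex numbers is missing.
  Dimensions are at least one because index types are nonempty.
\<close>

definition pointwise_scale ::
    "complex \<Rightarrow> (real^'m \<Rightarrow> complex^'n) \<Rightarrow> (real^'m \<Rightarrow> complex^'n)" where
  "pointwise_scale c f = (\<lambda>x. c *s f x)"

definition continuous_maps :: "(real^'m \<Rightarrow> complex^'n) set" where
  "continuous_maps = {f. continuous_on UNIV f}"

definition CS_inf :: "(real^'m \<Rightarrow> complex^'n) set" where
  "CS_inf = {f \<in> continuous_maps. \<forall>a. \<not> bounded (f -` {a})}"

lemma continuous_on_vec_mult:
  fixes f g :: "real^'m \<Rightarrow> complex^'n"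
  assumes "continuous_on UNIV f" "continuous_on UNIV g"
  shows "continuous_on UNIV (f * g)"
proof -
  have "f * g = (\<lambda>x. \<chi> i. f x $ i * g x $ i)"
    by (simp add: fun_eq_iff vec_eq_iff)
  then show ?thesis
    using assms by (auto intro!: continuous_intros)
qed

lemma continuous_on_pointwise_scale:
  assumes "continuous_on UNIV f"
  shows "continuous_on UNIV (pointwise_scale c f)"
  unfolding pointwise_scale_def vector_scalar_mult_def
  using assms by (auto intro!: continuous_intros)

global_interpretation continuous_maps:
  comm_complex_algebra pointwise_scale
    "continuous_maps :: (real^'m \<Rightarrow> complex^'n) set"
proof -
  interpret vector_space
    "pointwise_scale :: complex \<Rightarrow> (real^'m \<Rightarrow> complex^'n) \<Rightarrow> (real^'m \<Rightarrow> complex^'n)"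
    by unfold_locales
      (auto simp: pointwise_scale_def fun_eq_iff vec_eq_iff algebra_simps)
  show "comm_complex_algebra pointwise_scale
      (continuous_maps :: (real^'m \<Rightarrow> complex^'n) set)"
  proof
    fix c :: complex and x y :: "real^'m \<Rightarrow> complex^'n"
    show "pointwise_scale c (x * y) = pointwise_scale c x * y"
      by (auto simp: pointwise_scale_def fun_eq_iff vec_eq_iff)
  next
    show "subspace (continuous_maps :: (real^'m \<Rightarrow> complex^'n) set)"
      unfolding subspace_def continuous_maps_def zero_fun_def plus_fun_def
      by (auto intro!: continuous_on_add continuous_on_pointwise_scale)
  next
    fix x y :: "real^'m \<Rightarrow> complex^'n"
    assume "x \<in> continuous_maps" "y \<in> continuous_maps"
    then show "x * y \<in> continuous_maps"
      unfolding continuous_maps_def mem_Collect_eq by (rule continuous_on_vec_mult)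
  qed
qed

end

theory Submission
  imports Defs "HOL-Computational_Algebra.Fundamental_Theorem_Algebra"
begin

text \<open>
  The algebra has only continuum many elements, since a continuous map is determined by countably
  many bits (\<open>continuous_functions_lepoll_reals\<close>). It is therefore enough to produce a free
  system of continuum many generators \<open>generator i a\<close>, \<open>a > 0\<close>, such that nonzero
  polynomials without constant term in them lie in \<open>CS_inf\<close>; the cardinality of this system is
  then the required supremum.

  The generators depend on a single coordinate \<open>t = x $ i\<close>. Cut the positive half-line into the
  blocks \<open>[q, q + 1)\<close>. On block \<open>q\<close> a Schoenberg-type space-filling curve \<open>q * loop\<close>
  starts at \<open>0\<close>, returns to \<open>0\<close>, and covers in between all points of \<open>\<complex>\<^sup>n\<close> with
  coordinates smaller than \<open>q / 2\<close>. The generator with parameter \<open>a\<close> is, on this block, the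
  coordinatewise power of that curve with exponent \<open>expo a k \<approx> k powr a\<close>, where
  \<open>q = prod_encode (k, r)\<close>: every \<open>k\<close> is used on infinitely many blocks, hence with
  arbitrarily large amplitude \<open>q\<close>, while the vanishing of the curve at integers makes the glued
  function continuous although the exponents jump.

  Now let \<open>P\<close> be a nonzero polynomial without constant term and insert generators with distinct
  parameters \<open>\<alpha> l\<close>. On a block belonging to \<open>k\<close>, and in each coordinate, this gives
  a polynomial in one variable \<open>z\<close>, the position on the curve: a monomial with exponents
  \<open>e l\<close> turns into \<open>z\<close> to the power \<open>\<Sum>l. e l * expo (\<alpha> l) k\<close>. Because the functions
  \<open>k powr \<alpha> l\<close> have different orders of growth, different monomials of \<open>P\<close> have different
  powers as soon as \<open>k\<close> is large (\<open>weights_eventually_distinct\<close>), so nothing cancels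
  and the polynomial is not constant. By the fundamental theorem of algebra it attains
  the prescribed value in each coordinate at some \<open>z j\<close>. The curve passes through the point with
  these coordinates on every block of \<open>k\<close> with sufficiently large amplitude, which gives
  preimages arbitrarily far out.
\<close>

section \<open>A space-filling curve with infinitely many coordinates\<close>

text \<open>
  The curve follows Schoenberg's construction. The function \<open>wave\<close> has period \<open>2\<close> and is
  constantly \<open>0\<close> on \<open>[0, 1/3]\<close> and \<open>1\<close> on \<open>[2/3, 1]\<close>; thus it reads off the first
  ternary digit of a point of the Cantor set. A truncated cosine has these properties and is
  visibly continuous and periodic.
\<close>

definition wave :: "real \<Rightarrow> real" where
  "wave t = max 0 (min 1 (1 / 2 - cos (pi * t)))"

lemma wave_bounds: "0 \<le> wave t" "wave t \<le> 1"
  by (simp_all add: wave_def)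

lemma continuous_on_wave: "continuous_on UNIV wave"
  unfolding wave_def by (intro continuous_intros)

lemma wave_periodic: "wave (2 * of_int m + t) = wave t"
proof -
  have "cos (pi * (2 * of_int m + t)) = cos (pi * t + 2 * pi * of_int m)"
    by (simp add: algebra_simps)
  also have "\<dots> = cos (pi * t)"
    by (simp only: cos_add cos_int_2pin sin_int_2pin mult_1_right mult_zero_right diff_zero)
  finally show ?thesis by (simp add: wave_def)
qed

lemma wave_low:
  assumes "0 \<le> t" "t \<le> 1 / 3"
  shows "wave t = 0"
proof -
  have "cos (pi / 3) \<le> cos (pi * t)"
    using assms by (intro cos_monotone_0_pi_le) (auto simp: mult_le_cancel_left1)
  then show ?thesis by (simp add: wave_def cos_60)
qed

lemma wave_high:
  assumes "2 / 3 \<le> t" "t \<le> 1"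
  shows "wave t = 1"
proof -
  have "cos (pi * t) \<le> cos (pi * (2 / 3))"
    using assms by (intro cos_monotone_0_pi_le) (auto simp: mult_le_cancel_left1)
  also have "\<dots> = - 1 / 2" using cos_120 by (simp add: mult.commute)
  finally show ?thesis by (simp add: wave_def)
qed

lemma wave_even_integer: "wave (2 * of_int m) = 0"
  using wave_periodic[of m 0] by (simp add: wave_low)

text \<open>
  The point of the Cantor set with ternary digits \<open>2 * a i\<close>.
\<close>

definition ternary :: "(nat \<Rightarrow> nat) \<Rightarrow> real" where
  "ternary a = suminf (\<lambda>i. 2 * real (a i) / 3 ^ Suc i)"

lemma sums_two_thirds: "(\<lambda>i. 2 / 3 ^ Suc i :: real) sums 1"
proof -
  have "(\<lambda>i. (2 / 3) * (1 / 3) ^ i :: real) sums ((2 / 3) * (1 / (1 - 1 / 3)))"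
    by (intro sums_mult geometric_sums) simp
  then show ?thesis by (simp add: power_divide)
qed

lemma ternary_summable:
  assumes "\<And>i. a i \<le> 1"
  shows "summable (\<lambda>i. 2 * real (a i) / 3 ^ Suc i)"
proof (rule summable_comparison_test')
  show "summable (\<lambda>i. 2 / 3 ^ Suc i :: real)"
    using sums_two_thirds by (rule sums_summable)
  show "norm (2 * real (a i) / 3 ^ Suc i) \<le> 2 / 3 ^ Suc i" for i
    using assms[of i] by (simp add: divide_right_mono)
qed

lemma ternary_bounds:
  assumes "\<And>i. a i \<le> 1"
  shows "0 \<le> ternary a" "ternary a \<le> 1"
proof -
  show "0 \<le> ternary a"
    unfolding ternary_def by (intro suminf_nonneg ternary_summable assms) simp
  have "ternary a \<le> suminf (\<lambda>i. 2 / 3 ^ Suc i)"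
    unfolding ternary_def
    by (intro suminf_le ternary_summable assms sums_summable[OF sums_two_thirds])
      (use assms in \<open>simp add: divide_right_mono\<close>)
  then show "ternary a \<le> 1"
    using sums_unique[OF sums_two_thirds] by simp
qed

lemma ternary_rec:
  assumes "\<And>i. a i \<le> 1"
  shows "ternary a = 2 * real (a 0) / 3 + ternary (\<lambda>i. a (Suc i)) / 3"
proof -
  have "suminf (\<lambda>i. 2 * real (a (Suc i)) / 3 ^ Suc (Suc i)) = ternary a - 2 * real (a 0) / 3"
    using suminf_split_head[OF ternary_summable[of a, OF assms]] by (simp add: ternary_def)
  moreover have "suminf (\<lambda>i. 2 * real (a (Suc i)) / 3 ^ Suc i / 3) = ternary (\<lambda>i. a (Suc i)) / 3"
    unfolding ternary_def
    by (rule suminf_divide) (rule ternary_summable[of "\<lambda>i. a (Suc i)", OF assms])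
  ultimately show ?thesis by (simp add: field_simps)
qed

text \<open>
  Multiplication by \<open>3 ^ n\<close> shifts the digits by \<open>n\<close> places. The digits pushed in front of
  the point are even, so they contribute a multiple of the period of \<open>wave\<close>.
\<close>

lemma wave_digit:
  assumes a: "\<And>i. a i \<le> 1"
  shows "wave (3 ^ n * ternary a) = real (a n)"
proof -
  have shift: "\<exists>m::int. 3 ^ n * ternary a = 2 * of_int m + ternary (\<lambda>i. a (n + i))"
  proof (induction n)
    case 0
    show ?case by (rule exI[of _ 0]) simp
  next
    case (Suc n)
    then obtain m :: int where m: "3 ^ n * ternary a = 2 * of_int m + ternary (\<lambda>i. a (n + i))"
      by blast
    have "ternary (\<lambda>i. a (n + i)) = 2 * real (a n) / 3 + ternary (\<lambda>i. a (Suc n + i)) / 3"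
      using ternary_rec[of "\<lambda>i. a (n + i)"] a by simp
    then have "3 ^ Suc n * ternary a
        = 2 * of_int (3 * m + int (a n)) + ternary (\<lambda>i. a (Suc n + i))"
      using m by simp
    then show ?case by blast
  qed
  then obtain m :: int where m: "3 ^ n * ternary a = 2 * of_int m + ternary (\<lambda>i. a (n + i))"
    by blast
  have rec: "ternary (\<lambda>i. a (n + i)) = 2 * real (a n) / 3 + ternary (\<lambda>i. a (Suc n + i)) / 3"
    using ternary_rec[of "\<lambda>i. a (n + i)"] a by simp
  have bnds: "0 \<le> ternary (\<lambda>i. a (Suc n + i))" "ternary (\<lambda>i. a (Suc n + i)) \<le> 1"
    by (rule ternary_bounds, rule a)+
  have "wave (ternary (\<lambda>i. a (n + i))) = real (a n)"
  proof (cases "a n = 0")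
    case True
    then show ?thesis using rec bnds by (simp add: wave_low)
  next
    case False
    then have "a n = 1" using a[of n] by simp
    then show ?thesis using rec bnds by (simp add: wave_high)
  qed
  then show ?thesis by (simp add: m wave_periodic)
qed

lemma binary_expansion:
  assumes "0 \<le> v" "v < (1::real)"
  obtains a :: "nat \<Rightarrow> nat" where "\<And>k. a k \<le> 1" "(\<lambda>k. real (a k) / 2 ^ Suc k) sums v"
proof -
  define a where "a k = nat (\<lfloor>2 ^ Suc k * v\<rfloor> mod 2)" for k
  have digit: "a k \<le> 1" for k
    using pos_mod_bound[of 2 "\<lfloor>2 ^ Suc k * v\<rfloor>"] unfolding a_def by (simp only: nat_le_iff)
  \<comment> \<open>truncating the expansion is rounding down to a multiple of \<open>1 / 2 ^ K\<close>\<close>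
  have partial: "(\<Sum>k<K. real (a k) / 2 ^ Suc k) = of_int \<lfloor>2 ^ K * v\<rfloor> / 2 ^ K" for K
  proof (induction K)
    case 0
    then show ?case using assms by (simp add: floor_eq_iff)
  next
    case (Suc K)
    have half: "\<lfloor>2 ^ K * v\<rfloor> = \<lfloor>2 ^ Suc K * v\<rfloor> div 2"
      using floor_divide_real_eq_div[of 2 "2 ^ Suc K * v"] by simp
    have "\<lfloor>2 ^ Suc K * v\<rfloor> = 2 * \<lfloor>2 ^ K * v\<rfloor> + int (a K)"
      unfolding half a_def by simp
    then have "of_int \<lfloor>2 ^ Suc K * v\<rfloor> = 2 * of_int \<lfloor>2 ^ K * v\<rfloor> + real (a K)"
      by (metis of_int_add of_int_mult of_int_numeral of_int_of_nat_eq)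
    then show ?case using Suc by (simp add: add_divide_distrib)
  qed
  have "(\<lambda>K. of_int \<lfloor>2 ^ K * v\<rfloor> / 2 ^ K) \<longlonglongrightarrow> v"
  proof (rule real_tendsto_sandwich)
    show "\<forall>\<^sub>F K in sequentially. v - (1 / 2) ^ K \<le> of_int \<lfloor>2 ^ K * v\<rfloor> / 2 ^ K"
    proof (rule always_eventually, rule allI)
      fix K
      have "2 ^ K * v - 1 \<le> of_int \<lfloor>2 ^ K * v\<rfloor>" by linarith
      then have "(2 ^ K * v - 1) / 2 ^ K \<le> of_int \<lfloor>2 ^ K * v\<rfloor> / 2 ^ K"
        by (rule divide_right_mono) simp
      then show "v - (1 / 2) ^ K \<le> of_int \<lfloor>2 ^ K * v\<rfloor> / 2 ^ K"
        by (simp add: diff_divide_distrib power_divide)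
    qed
    show "\<forall>\<^sub>F K in sequentially. of_int \<lfloor>2 ^ K * v\<rfloor> / 2 ^ K \<le> v"
      by (intro always_eventually allI) (simp add: field_simps)
    show "(\<lambda>K. v - (1 / 2) ^ K) \<longlonglongrightarrow> v"
      by (rule tendsto_eq_intros LIMSEQ_power_zero | simp)+
  qed simp
  then have "(\<lambda>k. real (a k) / 2 ^ Suc k) sums v"
    by (simp only: sums_def partial)
  with digit show thesis by (rule that)
qed

text \<open>
  The digits of a point of the Cantor set are distributed over infinitely many coordinates by
  \<open>prod_encode\<close>, and each coordinate reads its digits as a binary expansion. Having all
  coordinates \<open>j\<close> available at once avoids any dependence on the dimension.
\<close>

definition space_fill :: "nat \<Rightarrow> real \<Rightarrow> real" where
  "space_fill j t = suminf (\<lambda>k. wave (3 ^ prod_encode (j, k) * t) / 2 ^ Suc k)"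

lemma continuous_on_space_fill: "continuous_on UNIV (space_fill j)"
proof (rule uniform_limit_theorem)
  show "uniform_limit UNIV (\<lambda>n t. \<Sum>k<n. wave (3 ^ prod_encode (j, k) * t) / 2 ^ Suc k)
          (space_fill j) sequentially"
    unfolding space_fill_def
  proof (rule Weierstrass_m_test)
    show "norm (wave (3 ^ prod_encode (j, k) * t) / 2 ^ Suc k) \<le> (1 / 2) ^ Suc k" for k t
      using wave_bounds by (simp add: power_divide divide_right_mono)
    show "summable (\<lambda>k. (1 / 2) ^ Suc k :: real)"
      using summable_geometric[of "1 / 2 :: real"] by (subst summable_Suc_iff) simp
  qed
  show "\<forall>\<^sub>F n in sequentially.
          continuous_on UNIV (\<lambda>t. \<Sum>k<n. wave (3 ^ prod_encode (j, k) * t) / 2 ^ Suc k)"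
    by (intro always_eventually allI continuous_intros continuous_on_compose2[OF continuous_on_wave])
      auto
qed simp

lemma space_fill_periodic: "space_fill j (2 * of_int m + t) = space_fill j t"
proof -
  have "wave (3 ^ i * (2 * of_int m + t)) = wave (3 ^ i * t)" for i
    using wave_periodic[of "3 ^ i * m" "3 ^ i * t"] by (simp add: algebra_simps)
  then show ?thesis by (simp only: space_fill_def)
qed

text \<open>
  Prescribe the digits: the binary digits of all \<open>v j\<close> are interleaved into one ternary
  expansion, from which \<open>wave\<close> recovers them exactly.
\<close>

lemma space_fill_surj:
  assumes "\<And>j. 0 \<le> v j" "\<And>j. v j < (1::real)"
  obtains t where "0 \<le> t" "t \<le> 1" "\<And>j. space_fill j t = v j"
proof -
  have "\<exists>a. (\<forall>k. a k \<le> 1) \<and> (\<lambda>k. real (a k) / 2 ^ Suc k) sums v j" for j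
    by (rule binary_expansion[OF assms]) blast
  then obtain d :: "nat \<Rightarrow> nat \<Rightarrow> nat" where d: "\<And>j k. d j k \<le> 1"
    and sums: "\<And>j. (\<lambda>k. real (d j k) / 2 ^ Suc k) sums v j"
    by metis
  define a where "a i = case_prod d (prod_decode i)" for i
  have a: "a i \<le> 1" for i using d by (simp add: a_def split_beta)
  have "space_fill j (ternary a) = v j" for j
    unfolding space_fill_def wave_digit[of a, OF a]
    using sums_unique[OF sums[of j]] by (simp add: a_def)
  then show ?thesis
    using that ternary_bounds[of a, OF a] by blast
qed

text \<open>
  The factor \<open>wave (2 * t)\<close> vanishes at the integers and equals \<open>1\<close> on the middle third of
  each unit interval. The scaling by \<open>12\<close> makes the curve run through more than a full period
  within that interval, so that the damping does not cost any values; subtracting \<open>1 / 2\<close>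
  centres the cube at the origin.
\<close>

definition loop :: "nat \<Rightarrow> real \<Rightarrow> complex" where
  "loop j t = of_real (wave (2 * t)) *
     Complex (space_fill (2 * j) (12 * t) - 1 / 2) (space_fill (2 * j + 1) (12 * t) - 1 / 2)"

lemma continuous_on_loop: "continuous_on UNIV (loop j)"
  unfolding loop_def
  by (intro continuous_intros continuous_on_compose2[OF continuous_on_wave]
      continuous_on_compose2[OF continuous_on_space_fill]) auto

lemma loop_int: "loop j (of_int l) = 0"
  by (simp add: loop_def wave_even_integer)

lemma loop_surj:
  assumes "\<And>j. cmod (u j) < 1 / 2"
  obtains t where "\<lfloor>t\<rfloor> = k" "\<And>j. loop j t = u j"
proof -
  define v where "v i = (if even i then Re (u (i div 2)) else Im (u (i div 2))) + 1 / 2" for i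
  have "\<bar>Re (u j)\<bar> < 1 / 2" "\<bar>Im (u j)\<bar> < 1 / 2" for j
    using assms[of j] abs_Re_le_cmod[of "u j"] abs_Im_le_cmod[of "u j"] by linarith+
  then have "- (1 / 2) < Re (u j) \<and> Re (u j) < 1 / 2 \<and> - (1 / 2) < Im (u j) \<and> Im (u j) < 1 / 2" for j
    by (metis abs_less_iff minus_less_iff)
  then have "0 \<le> v i" "v i < 1" for i
    by (smt (verit) v_def field_sum_of_halves)+
  then obtain s where s: "0 \<le> s" "s \<le> 1" "\<And>i. space_fill i s = v i"
    using space_fill_surj[of v] by metis
  \<comment> \<open>starting at the left end of the middle third puts \<open>12 * t\<close> at \<open>s\<close> modulo the period\<close>
  define t where "t = of_int k + 1 / 3 + s / 12"
  have "12 * t = 2 * of_int (6 * k + 2) + s" by (simp add: t_def)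
  then have "space_fill i (12 * t) = v i" for i
    by (simp only: space_fill_periodic s)
  moreover have "2 * t = 2 * of_int k + (2 / 3 + s / 6)" by (simp add: t_def)
  then have "wave (2 * t) = 1"
    using s by (simp only: wave_periodic) (simp add: wave_high)
  ultimately have "loop j t = u j" for j
    by (simp add: loop_def v_def complex_eq_iff)
  moreover have "\<lfloor>t\<rfloor> = k" using s by (simp add: t_def floor_eq_iff)
  ultimately show ?thesis using that by blast
qed

section \<open>Gluing along the integers\<close>

text \<open>
  At an integer both neighbouring pieces vanish, so each piece, extended to the closed interval,
  agrees with the glued function; closed intervals can be pasted together.
\<close>

lemma continuous_on_glue_floor:
  fixes F :: "int \<Rightarrow> real \<Rightarrow> 'b::real_normed_vector"
  assumes cont: "\<And>k. continuous_on UNIV (F k)" and zero: "\<And>k l. F k (of_int l) = 0"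
  shows "continuous_on UNIV (\<lambda>t. F \<lfloor>t\<rfloor> t)"
proof -
  let ?g = "\<lambda>t. F \<lfloor>t\<rfloor> t"
  have piece: "continuous_on {of_int k..of_int (k + 1)} ?g" for k
  proof (rule continuous_on_cong[THEN iffD1, OF refl _ continuous_on_subset[OF cont[of k]]])
    fix t :: real assume t: "t \<in> {of_int k..of_int (k + 1)}"
    show "F k t = F \<lfloor>t\<rfloor> t"
    proof (cases "t = of_int (k + 1)")
      case True
      then show ?thesis by (metis zero)
    next
      case False
      then have "\<lfloor>t\<rfloor> = k" using t by (auto simp: floor_eq_iff)
      then show ?thesis by simp
    qed
  qed simp
  have "isCont ?g t" for t
  proof -
    let ?k = "\<lfloor>t\<rfloor>"
    have "continuous_on ({of_int (?k - 1)..of_int (?k - 1 + 1)} \<union> {of_int ?k..of_int (?k + 1)}) ?g"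
      by (intro continuous_on_closed_Un piece) auto
    moreover have "{of_int (?k - 1)..of_int (?k - 1 + 1)} \<union> {of_int ?k..of_int (?k + 1)}
        = {of_int ?k - 1..of_int ?k + 1 :: real}" by auto
    ultimately have "continuous_on {of_int ?k - 1..of_int ?k + 1} ?g" by simp
    then show ?thesis
      by (rule continuous_on_interior) (simp; linarith)
  qed
  then show ?thesis by (simp add: continuous_at_imp_continuous_on)
qed

section \<open>Exponents of pairwise different growth\<close>

text \<open>
  The successor keeps the exponent positive, so that a power of a function vanishing at the
  integers vanishes there as well.
\<close>

definition expo :: "real \<Rightarrow> nat \<Rightarrow> nat" where
  "expo a k = Suc (nat \<lfloor>real k powr a\<rfloor>)"

lemma expo_growth:
  assumes "0 < b" "a \<le> b"
  shows "(\<lambda>k. real (expo a k) / real k powr b) \<longlonglongrightarrow> (if a = b then 1 else 0)"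
proof (rule real_tendsto_sandwich)
  have lim: "(\<lambda>k. real k powr (a - b)) \<longlonglongrightarrow> (if a = b then 1 else 0)"
  proof (cases "a = b")
    case True
    have "\<forall>\<^sub>F k in sequentially. real k powr 0 = 1"
      using eventually_gt_at_top[of 0] by eventually_elim simp
    then show ?thesis using True by (simp add: tendsto_eventually)
  next
    case False
    then show ?thesis
      using assms tendsto_neg_powr[OF _ filterlim_real_sequentially, of "a - b"] by simp
  qed
  then show "(\<lambda>k. real k powr (a - b)) \<longlonglongrightarrow> (if a = b then 1 else 0)" .
  have "(\<lambda>k. real k powr (- b)) \<longlonglongrightarrow> 0"
    using assms tendsto_neg_powr[OF _ filterlim_real_sequentially, of "- b"] by simp
  from tendsto_add[OF lim this]
  show "(\<lambda>k. real k powr (a - b) + real k powr (- b)) \<longlonglongrightarrow> (if a = b then 1 else 0)" by simp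
  have low: "real k powr a \<le> real (expo a k)" and up: "real (expo a k) \<le> real k powr a + 1" for k
  proof -
    have "real (expo a k) = of_int \<lfloor>real k powr a\<rfloor> + 1"
      by (simp add: expo_def)
    then show "real k powr a \<le> real (expo a k)" "real (expo a k) \<le> real k powr a + 1"
      by linarith+
  qed
  show "\<forall>\<^sub>F k in sequentially. real k powr (a - b) \<le> real (expo a k) / real k powr b"
    using low by (intro always_eventually allI) (simp add: powr_diff divide_right_mono)
  show "\<forall>\<^sub>F k in sequentially.
      real (expo a k) / real k powr b \<le> real k powr (a - b) + real k powr (- b)"
    using up by (intro always_eventually allI)
      (simp add: powr_diff powr_minus_divide divide_right_mono flip: add_divide_distrib)
qed

text \<open>
  A linear combination of functions of different orders of growth is governed by its fastest
  growing term: after division by that term's order of growth it tends to the coefficient, which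
  is not zero.
\<close>

lemma expo_independent:
  fixes d :: "'i \<Rightarrow> int"
  assumes fin: "finite I" and inj: "inj_on \<alpha> I" and pos: "\<And>i. i \<in> I \<Longrightarrow> 0 < \<alpha> i"
    and nz: "\<exists>i\<in>I. d i \<noteq> 0"
  shows "\<forall>\<^sub>F k in sequentially. (\<Sum>i\<in>I. d i * int (expo (\<alpha> i) k)) \<noteq> 0"
proof -
  let ?J = "{i \<in> I. d i \<noteq> 0}"
  obtain p where p: "p \<in> ?J" and max: "\<And>i. i \<in> ?J \<Longrightarrow> \<alpha> i \<le> \<alpha> p"
  proof -
    have "finite (\<alpha> ` ?J)" "\<alpha> ` ?J \<noteq> {}" using fin nz by auto
    from Max_in[OF this] Max_ge[OF this(1)] that show thesis by auto
  qed
  have "(\<lambda>k. \<Sum>i\<in>?J. of_int (d i) * (real (expo (\<alpha> i) k) / real k powr \<alpha> p))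
      \<longlonglongrightarrow> (\<Sum>i\<in>?J. of_int (d i) * (if \<alpha> i = \<alpha> p then 1 else 0))"
    using p pos max by (intro tendsto_intros expo_growth) auto
  also have "(\<Sum>i\<in>?J. of_int (d i) * (if \<alpha> i = \<alpha> p then 1 else 0)) = (\<Sum>i\<in>?J. if i = p then of_int (d p) else 0 :: real)"
    using p inj by (intro sum.cong) (auto dest: inj_onD)
  also have "\<dots> = of_int (d p)"
    using p fin by simp
  finally have "\<forall>\<^sub>F k in sequentially. 
      (\<Sum>i\<in>?J. of_int (d i) * (real (expo (\<alpha> i) k) / real k powr \<alpha> p)) \<noteq> 0"
    by (rule tendsto_imp_eventually_ne) (use p in simp)
  then show ?thesis
  proof eventually_elim
    case (elim k)
    have "(\<Sum>i\<in>?J. of_int (d i) * (real (expo (\<alpha> i) k) / real k powr \<alpha> p))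
        = of_int (\<Sum>i\<in>?J. d i * int (expo (\<alpha> i) k)) / real k powr \<alpha> p"
      by (simp only: of_int_sum of_int_mult of_int_of_nat_eq sum_divide_distrib times_divide_eq_right)
    moreover have "(\<Sum>i\<in>?J. d i * int (expo (\<alpha> i) k)) = (\<Sum>i\<in>I. d i * int (expo (\<alpha> i) k))"
      using fin by (intro sum.mono_neutral_left) auto
    ultimately show ?case using elim by (metis div_0 of_int_0)
  qed
qed

lemma expo_eventually_distinct:
  assumes "0 < a" "0 < b" "a \<noteq> b"
  shows "\<forall>\<^sub>F k in sequentially. expo a k \<noteq> expo b k"
proof -
  have "\<forall>\<^sub>F k in sequentially. (\<Sum>c\<in>{a, b}. (if c = a then 1 else - 1) * int (expo c k)) \<noteq> 0"
    using expo_independent[of "{a, b}" "\<lambda>c. c" "\<lambda>c. if c = a then 1 else - 1"] assms by auto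
  then show ?thesis
    by eventually_elim (use assms in auto)
qed

section \<open>Substituting powers of one variable\<close>

text \<open>
  The exponent of \<open>w\<close> in the monomial \<open>e\<close> once the variable with index \<open>l\<close> has been
  replaced by \<open>w ^ h l\<close>.
\<close>

definition weight :: "nat \<Rightarrow> (nat \<Rightarrow> nat) \<Rightarrow> (nat \<Rightarrow>\<^sub>0 nat) \<Rightarrow> nat" where
  "weight N h e = (\<Sum>l<N. Poly_Mapping.lookup e l * h l)"

lemma monomial_of_powers:
  fixes w :: "'a::comm_monoid_mult"
  assumes "Poly_Mapping.keys e \<subseteq> {..<N}"
  shows "(\<Prod>l\<in>Poly_Mapping.keys e. (w ^ h l) ^ Poly_Mapping.lookup e l) = w ^ weight N h e"
proof -
  have "(\<Prod>l\<in>Poly_Mapping.keys e. (w ^ h l) ^ Poly_Mapping.lookup e l)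
      = (\<Prod>l<N. (w ^ h l) ^ Poly_Mapping.lookup e l)"
    using assms by (intro prod.mono_neutral_left) (auto simp: in_keys_iff)
  also have "\<dots> = w ^ weight N h e"
    by (simp add: weight_def power_sum mult.commute flip: power_mult)
  finally show ?thesis .
qed

text \<open>
  The difference of the weights of two monomials is an integer combination of the exponents
  \<open>expo (\<alpha> l) k\<close> with a nonzero coefficient, and there are only finitely many pairs.
\<close>

lemma weights_eventually_distinct:
  assumes inj: "inj_on \<alpha> {..<N}" and pos: "\<And>l. l < N \<Longrightarrow> 0 < \<alpha> l"
    and fin: "finite E" and vars: "\<And>e. e \<in> E \<Longrightarrow> Poly_Mapping.keys e \<subseteq> {..<N}"
  shows "\<forall>\<^sub>F k in sequentially. inj_on (weight N (\<lambda>l. expo (\<alpha> l) k)) E"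
proof -
  have "\<forall>\<^sub>F k in sequentially. weight N (\<lambda>l. expo (\<alpha> l) k) e \<noteq> weight N (\<lambda>l. expo (\<alpha> l) k) e'"
    if e: "e \<in> E" "e' \<in> E" "e \<noteq> e'" for e e'
  proof -
    let ?d = "\<lambda>l. int (Poly_Mapping.lookup e l) - int (Poly_Mapping.lookup e' l)"
    obtain l where l: "Poly_Mapping.lookup e l \<noteq> Poly_Mapping.lookup e' l"
      using e(3) by (auto simp: poly_mapping_eq_iff fun_eq_iff)
    then have "l \<in> Poly_Mapping.keys e \<union> Poly_Mapping.keys e'"
      by (auto simp: in_keys_iff)
    then have "l < N" using vars e by auto
    with l have "\<exists>l\<in>{..<N}. ?d l \<noteq> 0" by auto
    then have "\<forall>\<^sub>F k in sequentially. (\<Sum>l<N. ?d l * int (expo (\<alpha> l) k)) \<noteq> 0"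
      by (intro expo_independent inj) (auto intro: pos)
    then show ?thesis
    proof eventually_elim
      case (elim k)
      have "(\<Sum>l<N. ?d l * int (expo (\<alpha> l) k))
          = int (weight N (\<lambda>l. expo (\<alpha> l) k) e) - int (weight N (\<lambda>l. expo (\<alpha> l) k) e')"
        by (simp add: weight_def left_diff_distrib sum_subtractf)
      with elim show ?case by auto
    qed
  qed
  then have "\<forall>\<^sub>F k in sequentially. e \<noteq> e' \<longrightarrow>
      weight N (\<lambda>l. expo (\<alpha> l) k) e \<noteq> weight N (\<lambda>l. expo (\<alpha> l) k) e'"
    if "e \<in> E" "e' \<in> E" for e e'
    using that by (cases "e = e'") auto
  then have "\<forall>\<^sub>F k in sequentially. \<forall>e\<in>E. \<forall>e'\<in>E. e \<noteq> e' \<longrightarrow>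
      weight N (\<lambda>l. expo (\<alpha> l) k) e \<noteq> weight N (\<lambda>l. expo (\<alpha> l) k) e'"
    using fin by (intro eventually_ball_finite ballI)
  then show ?thesis
    by eventually_elim (auto simp: inj_on_def)
qed

text \<open>
  Distinct weights prevent cancellation, so a monomial of \<open>P\<close> survives in the polynomial in
  one variable. Including \<open>0\<close>, the constant monomial, in the injectivity hypothesis makes the
  weight of the surviving monomial positive; hence the polynomial is not constant.
\<close>

lemma weighted_polynomial_surj:
  fixes P :: cpoly
  assumes P: "P \<noteq> 0" "no_constant_term P"
    and inj: "inj_on (weight N h) (insert 0 (Poly_Mapping.keys P))"
  obtains z where "(\<Sum>e\<in>Poly_Mapping.keys P. Poly_Mapping.lookup P e * z ^ weight N h e) = b"
proof -
  define Q where "Q = (\<Sum>e\<in>Poly_Mapping.keys P. monom (Poly_Mapping.lookup P e) (weight N h e))"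
  obtain e0 where e0: "e0 \<in> Poly_Mapping.keys P"
    using P(1) by fastforce
  have "e0 \<noteq> 0"
    using e0 P(2) by (auto simp: no_constant_term_def in_keys_iff)
  then have "weight N h e0 \<noteq> weight N h 0"
    using inj_onD[OF inj, of e0 0] e0 by blast
  moreover have "weight N h 0 = 0"
    by (simp add: weight_def)
  ultimately have pos: "weight N h e0 > 0"
    by linarith
  have "coeff Q (weight N h e0) = (\<Sum>e\<in>Poly_Mapping.keys P. if e = e0 then Poly_Mapping.lookup P e else 0)"
    unfolding Q_def coeff_sum using inj e0 by (intro sum.cong) (auto dest: inj_onD)
  also have "\<dots> = Poly_Mapping.lookup P e0"
    using e0 by simp
  finally have "coeff (Q - [:b:]) (weight N h e0) \<noteq> 0"
    using e0 pos by (simp add: in_keys_iff coeff_pCons split: nat.split)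
  then have "degree (Q - [:b:]) \<noteq> 0"
    using le_degree[of "Q - [:b:]" "weight N h e0"] pos by simp
  then obtain z where "poly (Q - [:b:]) z = 0"
    using fundamental_theorem_of_algebra[of "Q - [:b:]"] constant_degree[of "Q - [:b:]"] by metis
  then have "(\<Sum>e\<in>Poly_Mapping.keys P. Poly_Mapping.lookup P e * z ^ weight N h e) = b"
    by (simp add: Q_def poly_sum poly_monom)
  then show thesis by (rule that)
qed

section \<open>The generators\<close>

text \<open>
  The number of the block serves in two ways: as the amplitude, and, through its first component
  under \<open>prod_decode\<close>, as the argument of the exponent function. On the negative half-line the
  amplitude, and with it the function, is zero.
\<close>

definition block_power :: "real \<Rightarrow> nat \<Rightarrow> real \<Rightarrow> complex" where
  "block_power a j t =
     (of_nat (nat \<lfloor>t\<rfloor>) * loop j t) ^ expo a (fst (prod_decode (nat \<lfloor>t\<rfloor>)))"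

definition generator :: "'m \<Rightarrow> real \<Rightarrow> real^'m \<Rightarrow> complex^'n" where
  "generator i a x = (\<chi> j. block_power a (to_nat_on UNIV j) (x $ i))"

lemma continuous_on_block_power: "continuous_on UNIV (block_power a j)"
  unfolding block_power_def
  by (rule continuous_on_glue_floor[where
        F = "\<lambda>k t. (of_nat (nat k) * loop j t) ^ expo a (fst (prod_decode (nat k)))"])
    (auto intro!: continuous_intros continuous_on_loop simp: loop_int expo_def)

lemma continuous_on_generator: "continuous_on UNIV (generator i a)"
  unfolding generator_def
  by (intro continuous_intros continuous_on_compose2[OF continuous_on_block_power]) auto

text \<open>
  All generators follow the same curve and differ only in the exponent, so one parameter \<open>t\<close>
  works for all \<open>a\<close> simultaneously. Blocks \<open>prod_encode (k, r)\<close> with \<open>r\<close> large lie beyond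
  \<open>R\<close> and have sufficient amplitude.
\<close>

lemma generator_hits_powers:
  fixes z :: "'n::finite \<Rightarrow> complex"
  obtains t where "R \<le> t" "\<And>a x j. x $ i = t \<Longrightarrow> generator i a x $ j = z j ^ expo a k"
proof -
  define r where "r = nat \<lceil>max R (2 * (\<Sum>j\<in>UNIV. cmod (z j)))\<rceil> + 1"
  define q where "q = prod_encode (k, r)"
  have "R < real r" and r: "2 * (\<Sum>j\<in>UNIV. cmod (z j)) < real r"
    unfolding r_def by linarith+
  moreover have "r \<le> q" unfolding q_def by (rule le_prod_encode_2)
  moreover have "0 < r" by (simp add: r_def)
  ultimately have q: "R < real q" "2 * (\<Sum>j\<in>UNIV. cmod (z j)) < real q" "0 < q"
    by linarith+
  \<comment> \<open>the position within the normalised curve; every index \<open>l\<close> names some coordinate\<close>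
  define u where "u l = z (from_nat_into UNIV l) / of_nat q" for l
  have "cmod (u l) < 1 / 2" for l
  proof -
    have "cmod (z (from_nat_into UNIV l)) \<le> (\<Sum>j\<in>UNIV. cmod (z j))"
      by (rule member_le_sum) auto
    then show ?thesis using q by (simp add: u_def norm_divide field_simps)
  qed
  then obtain t where t: "\<lfloor>t\<rfloor> = int q" "\<And>l. loop l t = u l"
    using loop_surj[of u "int q"] by metis
  have "block_power a (to_nat_on UNIV j) t = z j ^ expo a k" for a j
    using q by (simp add: block_power_def t u_def q_def countable_finite)
  moreover have "R \<le> t" using t(1) q(1) by linarith
  ultimately show thesis
    using that by (simp add: generator_def)
qed

text \<open>
  Run the curve through the constant vector \<open>2\<close> on a block on which the exponents differ.
\<close>

lemma inj_on_generator:
  "inj_on (generator i :: real \<Rightarrow> real^'m \<Rightarrow> complex^'n) {0<..}"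
proof (rule inj_onI, rule ccontr)
  fix a b :: real
  assume ab: "a \<in> {0<..}" "b \<in> {0<..}" "a \<noteq> b"
    and eq: "(generator i a :: real^'m \<Rightarrow> complex^'n) = generator i b"
  obtain k where k: "expo a k \<noteq> expo b k"
    using eventually_happens[OF expo_eventually_distinct[of a b]] ab by auto
  obtain t where t: "\<And>a x j. x $ i = t \<Longrightarrow> (generator i a (x :: real^'m) :: complex^'n) $ j = 2 ^ expo a k"
    using generator_hits_powers[of 0 i "\<lambda>_. 2" k] by metis
  have "(2 :: complex) ^ expo a k = 2 ^ expo b k"
    using t[of "\<chi> _. t" a] t[of "\<chi> _. t" b] eq by simp
  then have "(of_nat (2 ^ expo a k) :: complex) = of_nat (2 ^ expo b k)"
    by simp
  then have "(2 :: nat) ^ expo a k = 2 ^ expo b k"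
    by (simp only: of_nat_eq_iff)
  with k show False by simp
qed

lemma eval_poly_nth:
  fixes x :: "nat \<Rightarrow> real^'m \<Rightarrow> complex^'n"
  shows "continuous_maps.eval_poly P x y $ j =
     (\<Sum>e\<in>Poly_Mapping.keys P. Poly_Mapping.lookup P e *
        (\<Prod>l\<in>Poly_Mapping.keys e. (x l y $ j) ^ Poly_Mapping.lookup e l))"
proof -
  have sum: "(\<Sum>e\<in>S. F e) y = (\<Sum>e\<in>S. F e y)" for S and F :: "_ \<Rightarrow> real^'m \<Rightarrow> complex^'n"
    by (induction S rule: infinite_finite_induct) auto
  have prod: "(\<Prod>e\<in>S. F e) y $ j = (\<Prod>e\<in>S. F e y $ j)" for S and F :: "_ \<Rightarrow> real^'m \<Rightarrow> complex^'n"
    by (induction S rule: infinite_finite_induct) auto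
  have pow: "(f ^ k) y $ j = (f y $ j) ^ k" for k and f :: "real^'m \<Rightarrow> complex^'n"
    by (induction k) auto
  show ?thesis
    by (simp add: continuous_maps.eval_poly_def pointwise_scale_def sum prod pow)
qed

text \<open>
  Choose \<open>k\<close> such that the weights are distinct, solve the resulting equation in one variable
  separately in each coordinate, and let the curve pass through the vector of solutions far out.
\<close>

lemma eval_poly_generators:
  fixes x :: "nat \<Rightarrow> real^'m \<Rightarrow> complex^'n"
  assumes inj: "inj_on \<alpha> {..<N}" and pos: "\<And>l. l < N \<Longrightarrow> 0 < \<alpha> l"
    and x: "\<And>l. l < N \<Longrightarrow> x l = generator i (\<alpha> l)"
    and P: "P \<noteq> 0" "poly_vars P \<subseteq> {..<N}" "no_constant_term P"
  shows "continuous_maps.eval_poly P x \<in> CS_inf - {0}"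
proof -
  let ?f = "continuous_maps.eval_poly P x"
  have vars: "Poly_Mapping.keys e \<subseteq> {..<N}" if "e \<in> Poly_Mapping.keys P" for e
    using P(2) that by (auto simp: poly_vars_def)
  have hit: "\<exists>y. R \<le> y $ i \<and> ?f y = b" for R b
  proof -
    have "\<forall>\<^sub>F k in sequentially.
        inj_on (weight N (\<lambda>l. expo (\<alpha> l) k)) (insert 0 (Poly_Mapping.keys P))"
      by (rule weights_eventually_distinct[OF inj pos]) (use vars in auto)
    then obtain k where k: "inj_on (weight N (\<lambda>l. expo (\<alpha> l) k)) (insert 0 (Poly_Mapping.keys P))"
      using eventually_happens trivial_limit_sequentially by blast
    have "\<exists>z. (\<Sum>e\<in>Poly_Mapping.keys P.
        Poly_Mapping.lookup P e * z ^ weight N (\<lambda>l. expo (\<alpha> l) k) e) = b $ j" for j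
      using weighted_polynomial_surj[OF P(1,3) k] by metis
    then obtain z where z: "\<And>j. (\<Sum>e\<in>Poly_Mapping.keys P.
        Poly_Mapping.lookup P e * z j ^ weight N (\<lambda>l. expo (\<alpha> l) k) e) = b $ j"
      by metis
    obtain t where t: "R \<le> t"
      "\<And>a y j. y $ i = t \<Longrightarrow> (generator i a (y :: real^'m) :: complex^'n) $ j = z j ^ expo a k"
      using generator_hits_powers[of R i z k] by metis
    define y :: "real^'m" where "y = (\<chi> _. t)"
    have mono: "(\<Prod>l\<in>Poly_Mapping.keys e. (x l y $ j) ^ Poly_Mapping.lookup e l)
        = z j ^ weight N (\<lambda>l. expo (\<alpha> l) k) e" if "e \<in> Poly_Mapping.keys P" for e j
    proof -
      have "x l y $ j = z j ^ expo (\<alpha> l) k" if "l \<in> Poly_Mapping.keys e" for l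
        using vars[OF \<open>e \<in> Poly_Mapping.keys P\<close>] that x t(2)[of y] by (auto simp: y_def)
      then show ?thesis
        using monomial_of_powers[OF vars[OF that], of "z j"] by simp
    qed
    have "?f y = b"
      by (simp add: vec_eq_iff eval_poly_nth mono z)
    moreover have "R \<le> y $ i" using t(1) by (simp add: y_def)
    ultimately show ?thesis by blast
  qed
  have "\<not> bounded (?f -` {b})" for b
  proof
    assume "bounded (?f -` {b})"
    then obtain B where B: "\<And>y. ?f y = b \<Longrightarrow> norm y \<le> B"
      by (auto simp: bounded_iff)
    obtain y where "B + 1 \<le> y $ i" "?f y = b"
      using hit by blast
    with B[of y] component_le_norm_cart[of y i] show False by linarith
  qed
  moreover have "continuous_on UNIV ?f"
  proof -
    have cont: "continuous_on UNIV (\<lambda>y. x l y $ j)" if "l < N" for l j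
      using continuous_on_generator[of i "\<alpha> l"] x[OF that] by (auto intro!: continuous_intros)
    have "continuous_on UNIV (\<lambda>y. \<chi> j. \<Sum>e\<in>Poly_Mapping.keys P. Poly_Mapping.lookup P e *
        (\<Prod>l\<in>Poly_Mapping.keys e. (x l y $ j) ^ Poly_Mapping.lookup e l))"
      using vars by (intro continuous_intros cont) auto
    then show ?thesis by (simp flip: eval_poly_nth)
  qed
  moreover have "?f \<noteq> 0"
  proof
    assume "?f = 0"
    then show False using hit[of 0 1] by simp
  qed
  ultimately show ?thesis
    by (auto simp: CS_inf_def continuous_maps_def)
qed

section \<open>Cardinality of the algebra\<close>

text \<open>
  With countable bases \<open>A\<close> and \<open>B\<close>, the function \<open>f\<close> is recovered from the set of pairs
  \<open>(U, V)\<close> of basic open sets with \<open>f ` U \<subseteq> V\<close>: if \<open>f y\<close> and \<open>g y\<close> differ, continuity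
  of \<open>f\<close> yields such a pair with \<open>y \<in> U\<close> and \<open>g y \<notin> V\<close>.
\<close>

lemma continuous_functions_lepoll_reals:
  "{f :: 'a::second_countable_topology \<Rightarrow> 'b::{second_countable_topology, t1_space}.
      continuous_on UNIV f} \<lesssim> (UNIV :: real set)"
proof -
  obtain A :: "'a set set" where A: "countable A" "topological_basis A"
    using ex_countable_basis by blast
  obtain B :: "'b set set" where B: "countable B" "topological_basis B"
    using ex_countable_basis by blast
  define code where "code f = {(U, V). U \<in> A \<and> V \<in> B \<and> f ` U \<subseteq> V}" for f :: "'a \<Rightarrow> 'b"
  have sub: "code f \<subseteq> code g \<Longrightarrow> f = g" if f: "continuous_on UNIV f" for f g
  proof (rule ccontr)
    assume code: "code f \<subseteq> code g" and "f \<noteq> g"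
    then obtain y where y: "f y \<noteq> g y" by auto
    then obtain W where W: "open W" "f y \<in> W" "g y \<notin> W"
      using t1_space by blast
    then obtain V where V: "V \<in> B" "f y \<in> V" "V \<subseteq> W"
      using topological_basisE[OF B(2)] by metis
    have "open (f -` V)"
      using f V(1) topological_basis_open[OF B(2)] by (simp add: continuous_on_open_vimage)
    then obtain U where U: "U \<in> A" "y \<in> U" "U \<subseteq> f -` V"
      using topological_basisE[OF A(2)] V(2) by (metis vimageI)
    then have "(U, V) \<in> code f" using V by (auto simp: code_def)
    then have "g y \<in> V" using code U by (auto simp: code_def)
    with V W show False by blast
  qed
  let ?n = "to_nat_on (A \<times> B)"
  have n: "inj_on ?n (A \<times> B)" using A B by (intro inj_on_to_nat_on) auto
  have "inj_on (\<lambda>f. ?n ` code f) {f. continuous_on UNIV f}"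
  proof (rule inj_onI)
    fix f g :: "'a \<Rightarrow> 'b"
    assume f: "f \<in> {f. continuous_on UNIV f}" and eq: "?n ` code f = ?n ` code g"
    have "code f \<subseteq> A \<times> B" "code g \<subseteq> A \<times> B" by (auto simp: code_def)
    with n eq have "code f = code g" by (simp add: inj_on_image_eq_iff)
    then show "f = g" using sub f by blast
  qed
  then have "{f :: 'a \<Rightarrow> 'b. continuous_on UNIV f} \<lesssim> (UNIV :: nat set set)"
    unfolding lepoll_def by blast
  also have "(UNIV :: nat set set) \<lesssim> (UNIV :: real set)"
    using nat_sets_eqpoll_reals by (rule eqpoll_imp_lepoll)
  finally show ?thesis .
qed

section \<open>Maximal strong algebrability\<close>

theorem theorem2p5:
  shows "comm_complex_algebra.maximal_strongly_algebrable pointwise_scale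
           (continuous_maps :: (real^'m \<Rightarrow> complex^'n) set)
           (CS_inf :: (real^'m \<Rightarrow> complex^'n) set)"
proof -
  fix i :: 'm
  let ?A = "continuous_maps :: (real^'m \<Rightarrow> complex^'n) set"
  define C where "C = (generator i :: real \<Rightarrow> real^'m \<Rightarrow> complex^'n) ` {0<..}"
  have C: "C \<subseteq> ?A"
    by (auto simp: C_def continuous_maps_def continuous_on_generator)
  have free: "continuous_maps.eval_poly P x \<in> CS_inf - {0}"
    if x: "inj_on x {..<N}" "x ` {..<N} \<subseteq> C"
      and P: "P \<noteq> 0" "poly_vars P \<subseteq> {..<N}" "no_constant_term P"
    for N x and P :: cpoly
  proof -
    have "\<forall>l\<in>{..<N}. \<exists>a. 0 < a \<and> x l = generator i a"
      using x(2) by (auto simp: C_def)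
    then obtain \<alpha> where \<alpha>: "\<And>l. l < N \<Longrightarrow> 0 < \<alpha> l" "\<And>l. l < N \<Longrightarrow> x l = generator i (\<alpha> l)"
      by (metis lessThan_iff)
    then have "inj_on \<alpha> {..<N}"
      using x(1) by (auto simp: inj_on_def)
    then show ?thesis
      using eval_poly_generators P \<alpha> by blast
  qed
  have above: "|D| \<le>o |C|" if "D \<subseteq> ?A" for D
  proof -
    have "D \<lesssim> ?A" using that by (rule subset_imp_lepoll)
    also have "?A \<lesssim> (UNIV :: real set)"
      unfolding continuous_maps_def by (rule continuous_functions_lepoll_reals)
    also have "(UNIV :: real set) \<lesssim> C"
      unfolding lepoll_def
    proof (intro exI conjI)
      show "inj_on (\<lambda>a. generator i (exp a) :: real^'m \<Rightarrow> complex^'n) UNIV"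
        by (rule inj_onI) (auto dest: inj_onD[OF inj_on_generator])
    qed (auto simp: C_def)
    finally show ?thesis by (simp add: lepoll_def card_of_ordLeq)
  qed
  have "continuous_maps.algebraically_free C"
    unfolding continuous_maps.algebraically_free_def using C free by blast
  moreover have "|D| \<le>o |C|" if "continuous_maps.algebraically_free D"
    for D :: "(real^'m \<Rightarrow> complex^'n) set"
    using that by (intro above) (simp add: continuous_maps.algebraically_free_def)
  ultimately have "is_card_Sup {|D| |D :: (real^'m \<Rightarrow> complex^'n) set. continuous_maps.algebraically_free D} |C|"
    unfolding is_card_Sup_def using card_of_Card_order by blast
  moreover have "continuous_maps.strongly_algebrable |C| (CS_inf :: (real^'m \<Rightarrow> complex^'n) set)"
    unfolding continuous_maps.strongly_algebrable_def
  proof (intro exI[of _ C] conjI allI impI)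
    show "|C| =o |C|" by (rule card_of_refl)
  qed (use C free in blast)+
  ultimately show ?thesis
    unfolding continuous_maps.maximal_strongly_algebrable_def by blast
qed

end
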